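(* Let $n\ge 1$ be an integer, let $v=(x_1,\dots,x_n)\in[-1,1]^n$ be a vector of real numbers, and let $$f_n(v):=\prod_{1\le i\le j\le n}\Big(1-\prod_{k=i}^{j}x_k\Big).$$ Then $$f_n(v)\le 2^{\lfloor\frac{n+1}{2}\rfloor}.$$ Moreover, the maximum is attained at $v$ (that is, $f_n(v)=2^{\lfloor\frac{n+1}{2}\rfloor}$) if and only if every coordinate of $v$ is $0$ or $-1$, no two consecutive coordinates of $v$ are both $-1$, and the number of coordinates of $v$ equal to $-1$ is the greatest possible among all vectors in $\{0,-1\}^n$ having no two consecutive coordinates equal to $-1$.
   Context: $\lfloor x\rfloor$ denotes the floor of the real number $x$. Consecutive coordinates of $v=(x_1,\dots,x_n)$ are $x_t,x_{t+1}$ with $1\le t\le n-1$. *)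

theory Defs
  imports "HOL-Analysis.Analysis"
begin

text \<open>
  A vector \<open>(x\<^sub>1, \<dots>, x\<^sub>n)\<close> is given by its length \<open>n\<close> and a function \<open>x :: nat \<Rightarrow> real\<close>, of which
  only the values at \<open>1, \<dots>, n\<close> matter.
\<close>

definition f :: "nat \<Rightarrow> (nat \<Rightarrow> real) \<Rightarrow> real" where
  "f n x = (\<Prod>(i, j) \<in> {(i, j). 1 \<le> i \<and> i \<le> j \<and> j \<le> n}. 1 - (\<Prod>k = i..j. x k))"

definition zero_minus_one_vector :: "nat \<Rightarrow> (nat \<Rightarrow> real) \<Rightarrow> bool" where
  "zero_minus_one_vector n x \<longleftrightarrow> (\<forall>t \<in> {1..n}. x t \<in> {0, -1})"

definition no_consecutive_minus_ones :: "nat \<Rightarrow> (nat \<Rightarrow> real) \<Rightarrow> bool" where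
  "no_consecutive_minus_ones n x \<longleftrightarrow>
     (\<forall>t. 1 \<le> t \<and> t + 1 \<le> n \<longrightarrow> \<not> (x t = -1 \<and> x (t + 1) = -1))"

definition num_minus_ones :: "nat \<Rightarrow> (nat \<Rightarrow> real) \<Rightarrow> nat" where
  "num_minus_ones n x = card {t \<in> {1..n}. x t = -1}"

end

theory Submission
  imports Defs
begin

text \<open>
  Consider the points \<open>0, \<dots>, n\<close> with the multiplicative kernel \<open>p i j = x\<^sub>i\<^sub>+\<^sub>1 \<cdots> x\<^sub>j\<close>, so that \<open>f\<close> is
  the product of \<open>1 - p i j\<close> over all pairs \<open>i < j\<close>, and give point \<open>j\<close> the sign \<open>s j\<close> of
  \<open>x\<^sub>1 \<cdots> x\<^sub>j\<close> (a zero coordinate counting as positive), so that \<open>p i j\<close> has sign \<open>s i * s j\<close>.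
  The walk of partial sums of the signs has its first minimum or first maximum either strictly
  inside, between neighbours \<open>i, j\<close> of opposite signs, or both are at the ends. In the first case the
  factors that involve \<open>i\<close> or \<open>j\<close> have product at most 2, because the ballot property of the
  walk matches every factor pair exceeding 1 with a pair nearer to \<open>i, j\<close> that compensates
  it, except one, which is absorbed into \<open>1 - p i j\<close>. In the second case the factors that
  involve the last point have product at most 1 for the same reason. Deleting these points and
  inducting gives \<open>2 ^ (m div 2)\<close> for \<open>m = n + 1\<close> points. In each of these estimates
  equality forces all values of \<open>p\<close> involved to be 0 or -1.
\<close>

section \<open>Sign walks: ballot sequences and pivots\<close>

text \<open>The start value \<open>c\<close> is the surplus of positive signs brought in from
  outside; it makes the condition recursive in the list. Values of \<open>k\<close> past the end
  repeat the full sum, because \<open>take\<close> saturates.\<close>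

definition ballot :: "int \<Rightarrow> int list \<Rightarrow> bool" where
  "ballot c gs \<longleftrightarrow> (\<forall>k. 0 \<le> c + sum_list (take k gs))"

lemma ballot_Nil [simp]: "ballot c [] \<longleftrightarrow> 0 \<le> c"
  by (simp add: ballot_def)

lemma ballot_Cons [simp]: "ballot c (g # gs) \<longleftrightarrow> 0 \<le> c \<and> ballot (c + g) gs"
proof -
  have "(\<forall>k. P k) \<longleftrightarrow> P 0 \<and> (\<forall>k. P (Suc k))" for P :: "nat \<Rightarrow> bool"
    by (metis not0_implies_Suc)
  from this[of "\<lambda>k. 0 \<le> c + sum_list (take k (g # gs))"] show ?thesis
    by (simp add: ballot_def add.assoc)
qed

lemma ballot_nonneg: "ballot c gs \<Longrightarrow> 0 \<le> c"
  by (cases gs) auto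

lemma ballot_map_mult: "ballot c (map ((*) a) gs) \<longleftrightarrow> (\<forall>k. 0 \<le> c + a * sum_list (take k gs))"
  by (simp add: ballot_def take_map sum_list_const_mult[of a "\<lambda>x. x", simplified])

lemma sum_list_take_drop:
  fixes ss :: "int list"
  shows "sum_list (take k (drop i ss)) = sum_list (take (i + k) ss) - sum_list (take i ss)"
  by (simp add: take_add)

lemma sum_list_take_rev_take:
  fixes ss :: "int list"
  assumes "i \<le> length ss"
  shows "sum_list (take k (rev (take i ss))) = sum_list (take i ss) - sum_list (take (i - k) ss)"
proof -
  have "take i ss = take (i - k) ss @ drop (i - k) (take i ss)"
    by (metis append_take_drop_id diff_le_self min.absorb1 take_take)
  then have "sum_list (take i ss) = sum_list (take (i - k) ss) + sum_list (drop (i - k) (take i ss))"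
    by (metis sum_list_append)
  moreover have "take k (rev (take i ss)) = rev (drop (i - k) (take i ss))"
    using assms by (simp add: take_rev min_def)
  ultimately show ?thesis
    by (simp add: sum_list.rev)
qed

text \<open>A pivot is a pair of neighbours whose deletion costs a factor of at most 2.\<close>

definition pivot :: "int list \<Rightarrow> bool" where
  "pivot ss \<longleftrightarrow> (\<exists>L a b R. ss = L @ a # b # R \<and> b = - a \<and>
     ballot 1 (map ((*) b) R) \<and> ballot 0 (map ((*) a) (rev L)))"

lemma pivot_uminus: "pivot (map uminus ss) \<Longrightarrow> pivot ss"
proof -
  assume "pivot (map uminus ss)"
  then obtain L a b R where *: "map uminus ss = L @ a # b # R" "b = - a"
    "ballot 1 (map ((*) b) R)" "ballot 0 (map ((*) a) (rev L))"
    unfolding pivot_def by blast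
  have "ss = map uminus (map uminus ss)" by (simp add: o_def)
  also have "\<dots> = map uminus L @ (- a) # (- b) # map uminus R" by (simp only: * list.map map_append)
  finally have "ss = map uminus L @ (- a) # (- b) # map uminus R" .
  moreover have "map ((*) (- b)) (map uminus R) = map ((*) b) R"
    "map ((*) (- a)) (rev (map uminus L)) = map ((*) a) (rev L)"
    by (simp_all add: o_def rev_map)
  ultimately show ?thesis
    unfolding pivot_def using * by (metis minus_minus)
qed

text \<open>At an interior first minimum \<open>i\<close> the walk steps down into \<open>i\<close>
  and up out of it. After the step up it stands one above the minimum, which gives offset 1 on the
  right. On the left all earlier values are strictly above \<open>W i\<close>, hence at least
  \<open>W l\<close> with \<open>l = i - 1\<close>, which gives offset 0.\<close>

lemma pivot_of_argmin:
  fixes ss :: "int list"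
  defines "W \<equiv> \<lambda>k. sum_list (take k ss)"
  assumes signs: "set ss \<subseteq> {1, -1}" and i: "0 < i" "i < length ss"
    and min: "\<And>k. W i \<le> W k" and first: "\<And>k. k < i \<Longrightarrow> W i < W k"
  shows "pivot ss"
proof -
  obtain l where l: "i = Suc l" using i(1) not0_implies_Suc by blast
  have W_Suc: "W (Suc k) = W k + ss ! k" if "k < length ss" for k
    using that by (simp add: W_def take_Suc_conv_app_nth)
  have sgn: "ss ! k = 1 \<or> ss ! k = -1" if "k < length ss" for k
    using signs that nth_mem by blast
  have a: "ss ! l = -1"
    using first[of l] W_Suc[of l] sgn[of l] i l by auto
  have b: "ss ! i = 1"
    using min[of "Suc i"] W_Suc[of i] sgn[of i] i l by auto
  have Wi: "W i = W l - 1" "W (Suc i) = W i + 1"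
    using a b W_Suc[of l] W_Suc[of i] i l by auto
  have "ss = take l ss @ ss ! l # ss ! i # drop (Suc i) ss"
    using i l by (metis Cons_nth_drop_Suc Suc_lessD append_take_drop_id)
  moreover have "ballot 1 (map ((*) 1) (drop (Suc i) ss))"
  proof -
    have "0 \<le> 1 + (W (Suc i + k) - W (Suc i))" for k
      using min[of "Suc i + k"] Wi(2) by simp
    then show ?thesis
      unfolding ballot_map_mult sum_list_take_drop W_def by simp
  qed
  moreover have "ballot 0 (map ((*) (-1)) (rev (take l ss)))"
  proof -
    have "0 \<le> W (l - k) - W l" for k
    proof -
      have "l - k < i" using l by simp
      from first[OF this] show ?thesis using Wi(1) by simp
    qed
    moreover have "l \<le> length ss" using i l by simp
    ultimately show ?thesis
      unfolding ballot_map_mult by (simp add: sum_list_take_rev_take W_def)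
  qed
  ultimately show ?thesis
    unfolding pivot_def using a b by (metis minus_minus)
qed

text \<open>
  The walk of partial sums either has its first minimum or its first maximum strictly inside, which
  is a pivot, or takes its extreme values only at the end points.
\<close>

lemma pivot_or_dominant_last:
  assumes signs: "set ss \<subseteq> {1, -1 :: int}" and "ss \<noteq> []"
  shows "pivot ss \<or> (\<exists>L a. ss = L @ [a] \<and> ballot 0 (map ((*) a) (rev L)))"
proof -
  have first_argmin: "\<exists>i \<le> length ts. (\<forall>k. sum_list (take i ts) \<le> sum_list (take k ts)) \<and>
      (\<forall>k<i. sum_list (take i ts) < sum_list (take k ts))" for ts :: "int list"
  proof -
    let ?W = "\<lambda>k. sum_list (take k ts)"
    let ?M = "Min (?W ` {..length ts})"
    have "?M \<in> ?W ` {..length ts}" by (rule Min_in) auto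
    then obtain i0 where "?M = ?W i0" by (rule imageE)
    then have ex: "\<exists>i. ?W i = ?M" by (intro exI) (rule sym)
    define i where "i = (LEAST i. ?W i = ?M)"
    have Wi: "?W i = ?M" unfolding i_def using ex by (rule LeastI_ex)
    have le: "?M \<le> ?W k" for k
    proof -
      have "?W k = ?W (min k (length ts))" by (simp add: min_def)
      then have "?W k \<in> ?W ` {..length ts}" by (metis atMost_iff imageI min.cobounded2)
      then show ?thesis by (intro Min_le) auto
    qed
    have "?W i < ?W k" if "k < i" for k
      using not_less_Least[of k "\<lambda>i. ?W i = ?M"] that le[of k] Wi unfolding i_def by linarith
    moreover have "i \<le> length ts"
    proof (rule ccontr)
      assume "\<not> i \<le> length ts"
      with calculation[of "length ts"] show False by simp
    qed
    ultimately show ?thesis using Wi le by metis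
  qed
  \<comment> \<open>The sign \<open>e\<close> treats a final strict maximum (1) and a final strict
    minimum (-1) together. Strictness just before the end forces the last step to be
    \<open>e\<close>; strictness elsewhere, by integrality, survives its removal as a weak
    inequality.\<close>
  have last: ?thesis if "e = 1 \<or> e = -1"
    and last_max: "\<And>k. k < length ss \<Longrightarrow> e * sum_list (take k ss) < e * sum_list ss" for e
  proof -
    obtain L a where L: "ss = L @ [a]" using \<open>ss \<noteq> []\<close> by (metis rev_exhaust)
    have "e * sum_list L < e * sum_list ss" using last_max[of "length L"] L by simp
    then have "a = e" using signs L that(1) by auto
    have "0 \<le> a * (sum_list L - sum_list (take (length L - k) L))" for k
    proof -
      have "length L - k < length ss" using L by simp
      from last_max[OF this] show ?thesis using L \<open>a = e\<close> that(1) by auto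
    qed
    then have "ballot 0 (map ((*) a) (rev L))"
      using sum_list_take_rev_take[of "length L" L] unfolding ballot_map_mult by simp
    with L show ?thesis by blast
  qed
  obtain i where i: "i \<le> length ss" "\<And>k. sum_list (take i ss) \<le> sum_list (take k ss)"
    "\<And>k. k < i \<Longrightarrow> sum_list (take i ss) < sum_list (take k ss)"
    using first_argmin[of ss] by blast
  have "sum_list (map uminus ts) = - sum_list ts" for ts :: "int list"
    by (induction ts) auto
  then have neg: "sum_list (take k (map uminus ss)) = - sum_list (take k ss)" for k
    by (simp add: take_map)
  obtain j where j: "j \<le> length ss" "\<And>k. sum_list (take j ss) \<ge> sum_list (take k ss)"
    "\<And>k. k < j \<Longrightarrow> sum_list (take j ss) > sum_list (take k ss)"
    using first_argmin[of "map uminus ss"] by (auto simp: neg)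
  consider "0 < i" "i < length ss" | "i = length ss" | "0 < j" "j < length ss" | "j = length ss"
    | "i = 0" "j = 0" using i(1) j(1) by linarith
  then show ?thesis
  proof cases
    case 1
    then show ?thesis using pivot_of_argmin[OF signs] i by blast
  next
    case 2
    then show ?thesis using last[of "-1"] i by simp
  next
    case 3
    have "set (map uminus ss) \<subseteq> {1, -1}" using signs by auto
    then have "pivot (map uminus ss)"
      using pivot_of_argmin[of "map uminus ss" j] 3 j by (simp add: neg)
    then show ?thesis using pivot_uminus by blast
  next
    case 4
    then show ?thesis using last[of 1] j by simp
  next
    case 5
    \<comment> \<open>Maximum and minimum both equal to the value at 0 would make the walk constant,
      but its first step is 1 or -1.\<close>
    obtain a ts where "ss = a # ts" using \<open>ss \<noteq> []\<close> list.exhaust by blast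
    then have "sum_list (take 1 ss) \<noteq> 0" using signs by auto
    then show ?thesis using i(2)[of 1] j(2)[of 1] 5 by simp
  qed
qed

section \<open>Estimates for the factor \<open>phi\<close>\<close>

text \<open>
  When neighbours \<open>i, j\<close> with \<open>p i j = - r\<close> are deleted, a point \<open>k\<close> beyond \<open>j\<close> contributes
  \<open>(1 - p j k) * (1 - p i k) = phi r (p j k)\<close>; symmetrically on the other side. Deletion of a
  single point is the case \<open>r = 0\<close>.
\<close>

definition phi :: "real \<Rightarrow> real \<Rightarrow> real" where
  "phi r q = (1 - q) * (1 + r * q)"

lemma phi_antimono:
  assumes "0 \<le> r" "r \<le> 1" "0 \<le> b" "b \<le> z"
  shows "phi r z \<le> phi r b"
proof -
  have "phi r b - phi r z = (z - b) * ((1 - r) + r * (z + b))"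
    by (simp add: phi_def algebra_simps)
  also have "\<dots> \<ge> 0" using assms by simp
  finally show ?thesis by simp
qed

lemma phi_nonneg: "0 \<le> r \<Longrightarrow> r \<le> 1 \<Longrightarrow> \<bar>q\<bar> \<le> 1 \<Longrightarrow> 0 \<le> phi r q"
proof -
  assume *: "0 \<le> r" "r \<le> 1" "\<bar>q\<bar> \<le> 1"
  have "\<bar>r * q\<bar> \<le> 1" using * by (simp add: abs_mult mult_le_one)
  then show ?thesis using * unfolding phi_def by (intro mult_nonneg_nonneg) auto
qed

lemma phi_0 [simp]: "phi r 0 = 1"
  by (simp add: phi_def)

lemma phi_le_1: "0 \<le> r \<Longrightarrow> r \<le> 1 \<Longrightarrow> 0 \<le> b \<Longrightarrow> phi r b \<le> 1"
  using phi_antimono[of r 0 b] by simp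

lemma phi_eq_1:
  assumes "0 \<le> r" "r \<le> 1" "0 \<le> b" "1 \<le> phi r b"
  shows "b = 0"
proof (rule ccontr)
  assume "b \<noteq> 0"
  with assms have b: "b > 0" by simp
  have "b * ((1 - r) + r * b) = 1 - phi r b" by (simp add: phi_def algebra_simps)
  with assms(4) have "b * ((1 - r) + r * b) \<le> 0" by simp
  moreover have "(1 - r) + r * b > 0"
    using assms b by (cases "r = 1") (auto intro!: add_pos_nonneg)
  ultimately show False using b by (simp add: mult_le_0_iff)
qed

text \<open>This is the compensation behind the matching: two factors of opposite sign and equal
  magnitude multiply to at most 1.\<close>

lemma phi_mult_uminus: "phi r b * phi r (- b) = (1 - b\<^sup>2) * (1 - (r * b)\<^sup>2)"
  by (simp add: phi_def power2_eq_square algebra_simps)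

lemma phi_mult_uminus_le_1:
  assumes "0 \<le> r" "r \<le> 1" "0 \<le> b" "b \<le> 1"
  shows "phi r b * phi r (- b) \<le> 1" and "phi r b * phi r (- b) \<ge> 1 \<Longrightarrow> b = 0"
proof -
  have rb: "0 \<le> (r * b)\<^sup>2" "(r * b)\<^sup>2 \<le> 1" and b: "0 \<le> b\<^sup>2" "b\<^sup>2 \<le> 1"
    using assms by (auto simp: abs_mult mult_le_one abs_square_le_1)
  have "phi r b * phi r (- b) \<le> 1 - b\<^sup>2"
    unfolding phi_mult_uminus using rb b by (intro mult_left_le) auto
  with b show "phi r b * phi r (- b) \<le> 1" and "phi r b * phi r (- b) \<ge> 1 \<Longrightarrow> b = 0"
    by (linarith, smt (verit) power2_eq_square zero_eq_power2)
qed

text \<open>Here \<open>1 + r\<close> is the factor of the deleted pair itself, and it absorbs the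
  one negative factor left unmatched. The defect from 2 is a sum of two nonnegative terms, and both
  vanish only at the two listed corners.\<close>

lemma one_plus_mult_phi_uminus:
  assumes "0 \<le> r" "r \<le> 1" "0 \<le> b" "b \<le> 1"
  shows "(1 + r) * phi r (- b) \<le> 2"
    and "(1 + r) * phi r (- b) \<ge> 2 \<Longrightarrow> (r = 1 \<and> b = 0) \<or> (r = 0 \<and> b = 1)"
proof -
  have eq: "2 - (1 + r) * phi r (- b) = (1 - r) * (1 - b) * (1 - r * b) + 2 * (r * b)\<^sup>2"
    by (simp add: phi_def power2_eq_square algebra_simps)
  have "r * b \<le> 1" using assms by (simp add: mult_le_one)
  then have pos: "0 \<le> (1 - r) * (1 - b) * (1 - r * b)" using assms by simp
  with eq show "(1 + r) * phi r (- b) \<le> 2" by (smt (verit) zero_le_power2)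
  assume "(1 + r) * phi r (- b) \<ge> 2"
  with eq pos have "(r * b)\<^sup>2 = 0" "(1 - r) * (1 - b) * (1 - r * b) = 0"
    by (smt (verit) zero_le_power2)+
  then show "(r = 1 \<and> b = 0) \<or> (r = 0 \<and> b = 1)" by auto
qed

lemma phi_power_ge_1:
  assumes "0 \<le> r" "r \<le> 1" "0 \<le> z" "z \<le> 1"
  shows "phi r z ^ c \<le> 1" and "1 \<le> phi r z ^ c \<Longrightarrow> c = 0 \<or> z = 0"
proof -
  have phi: "0 \<le> phi r z" "phi r z \<le> 1"
    using assms phi_nonneg[of r z] phi_le_1[of r z] by auto
  then show le: "phi r z ^ c \<le> 1" by (simp add: power_le_one)
  assume ge: "1 \<le> phi r z ^ c"
  show "c = 0 \<or> z = 0"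
  proof (cases c)
    case (Suc d)
    have "phi r z ^ c \<le> phi r z"
      unfolding Suc using phi by (simp add: mult_left_le power_le_one)
    then show ?thesis using ge phi_eq_1[of r z] assms by simp
  qed simp
qed

text \<open>Passes equality in a product of upper bounds on to each factor; every equality case
  below is split by it.\<close>

lemma mult_ge_cancel:
  fixes X Y M N :: real
  assumes "0 \<le> X" "X \<le> M" "0 \<le> Y" "Y \<le> N" "0 < M" "0 < N" "X * Y \<ge> M * N"
  shows "X = M" and "Y = N"
proof -
  have "X * Y \<le> M * Y" "X * Y \<le> X * N"
    using assms by (simp_all add: mult_right_mono mult_left_mono)
  with assms(7) have "M * N \<le> M * Y" "M * N \<le> X * N" by linarith+
  with assms show "X = M" "Y = N" by (simp_all add: mult_le_cancel_left mult_le_cancel_right)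
qed

section \<open>Products of \<open>phi\<close> along ballot sequences\<close>

lemma prod_list_phi_nonneg:
  fixes g :: "'a \<Rightarrow> int"
  assumes "0 \<le> r" "r \<le> 1" "\<forall>k\<in>set ks. (g k = 1 \<or> g k = -1) \<and> 0 \<le> b k \<and> b k \<le> z" "z \<le> 1"
  shows "0 \<le> (\<Prod>k\<leftarrow>ks. phi r (of_int (g k) * b k))"
proof -
  have "0 \<le> phi r (of_int (g k) * b k)" if "k \<in> set ks" for k
    using assms that by (intro phi_nonneg) (force simp: abs_mult)+
  then show ?thesis by (induction ks) auto
qed

text \<open>
  Of the factors read so far, \<open>c\<close> more have positive sign than negative sign, and \<open>phi r z ^ c\<close>
  stands for their product: a factor of negative sign is absorbed by any earlier one of positive sign.
\<close>

lemma ballot_prod_le_1: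
  fixes g :: "'a \<Rightarrow> int" and b :: "'a \<Rightarrow> real"
  assumes r: "0 \<le> r" "r \<le> 1"
    and "\<forall>k\<in>set ks. (g k = 1 \<or> g k = -1) \<and> 0 \<le> b k \<and> b k \<le> z" "0 \<le> z" "z \<le> 1"
    and "sorted_wrt (\<lambda>k l. b l \<le> b k) ks"
    and "ballot (int c) (map g ks)"
  shows "phi r z ^ c * (\<Prod>k\<leftarrow>ks. phi r (of_int (g k) * b k)) \<le> 1 \<and>
    (1 \<le> phi r z ^ c * (\<Prod>k\<leftarrow>ks. phi r (of_int (g k) * b k)) \<longrightarrow>
      (c = 0 \<or> z = 0) \<and> (\<forall>k\<in>set ks. b k = 0))"
  using assms(3-)
proof (induction ks arbitrary: c z)
  case Nil
  then show ?case using phi_power_ge_1[OF r, of z c] by auto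
next
  case (Cons k ks)
  let ?P = "\<Prod>k\<leftarrow>ks. phi r (of_int (g k) * b k)"
  have b: "0 \<le> b k" "b k \<le> z" "b k \<le> 1" using Cons.prems by auto
  have prems: "\<forall>l\<in>set ks. (g l = 1 \<or> g l = -1) \<and> 0 \<le> b l \<and> b l \<le> b k"
    "sorted_wrt (\<lambda>k l. b l \<le> b k) ks"
    using Cons.prems by auto
  have P: "0 \<le> ?P" using prod_list_phi_nonneg[OF r prems(1) b(3)] .
  have mono: "phi r z \<le> phi r (b k)" using phi_antimono r b by blast
  have nonneg: "0 \<le> phi r z" "0 \<le> phi r (b k)" "0 \<le> phi r (- b k)"
    using r b Cons.prems by (auto intro!: phi_nonneg)
  consider "g k = 1" | "g k = -1" using Cons.prems by auto
  then show ?case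
  proof cases
    case 1
    \<comment> \<open>The threshold drops from \<open>z\<close> to \<open>b k\<close>. The stored
      factors only grow, as \<open>phi\<close> is antimonotone, and the factor just read becomes one
      more copy at the new threshold.\<close>
    have "ballot (int (Suc c)) (map g ks)" using Cons.prems 1 by (simp add: add.commute)
    then have IH: "phi r (b k) ^ Suc c * ?P \<le> 1"
      "1 \<le> phi r (b k) ^ Suc c * ?P \<Longrightarrow> b k = 0 \<and> (\<forall>l\<in>set ks. b l = 0)"
      using Cons.IH[OF prems(1) b(1,3) prems(2), of "Suc c"] by blast+
    have "phi r z ^ c * (phi r (b k) * ?P) \<le> phi r (b k) ^ c * (phi r (b k) * ?P)"
      using power_mono[OF mono nonneg(1), of c] P nonneg by (intro mult_right_mono) auto
    then have le: "phi r z ^ c * (phi r (b k) * ?P) \<le> phi r (b k) ^ Suc c * ?P"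
      by (simp add: mult_ac)
    have "(c = 0 \<or> z = 0) \<and> (\<forall>l\<in>set (k # ks). b l = 0)"
      if ge: "1 \<le> phi r z ^ c * (phi r (b k) * ?P)"
    proof -
      have zero: "b k = 0" "\<forall>l\<in>set ks. b l = 0" using IH(2)[OF order_trans[OF ge le]] by blast+
      \<comment> \<open>The induction hypothesis was used at threshold \<open>b k\<close>, so it
        tells nothing about the old \<open>c\<close> and \<open>z\<close>; these are recovered from
        the power that remains.\<close>
      have "?P \<le> 1" using IH(1) unfolding zero(1) by simp
      then have "phi r z ^ c * ?P \<le> phi r z ^ c" using nonneg by (simp add: mult_left_le)
      then have "1 \<le> phi r z ^ c" using ge unfolding zero(1) by simp
      then have "c = 0 \<or> z = 0" using phi_power_ge_1(2)[OF r] Cons.prems(2,3) by blast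
      then show ?thesis using zero by simp
    qed
    moreover have eq: "(\<Prod>k\<leftarrow>k # ks. phi r (of_int (g k) * b k)) = phi r (b k) * ?P"
      using 1 by simp
    ultimately show ?thesis unfolding eq using order_trans[OF le IH(1)] by blast
  next
    case 2
    \<comment> \<open>After a negative sign the surplus is still nonnegative, so a stored positive
      factor is available for the match.\<close>
    then obtain d where c: "c = Suc d" using Cons.prems ballot_nonneg[of "int c - 1" "map g ks"] by (cases c) auto
    have "ballot (int d) (map g ks)" using Cons.prems 2 c by simp
    note IH = Cons.IH[OF prems(1) b(1,3) prems(2) this]
    \<comment> \<open>\<open>?X\<close> is the matched pair. Raising its stored factor from
      \<open>z\<close> to \<open>b k\<close> bounds it by a pair of equal magnitudes.\<close>
    let ?X = "phi r z * phi r (- b k)" and ?Y = "phi r (b k) ^ d * ?P"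
    have X: "?X \<le> phi r (b k) * phi r (- b k)" using mono nonneg by (simp add: mult_right_mono)
    have X1: "0 \<le> ?X" "?X \<le> 1"
      using X phi_mult_uminus_le_1(1)[OF r b(1,3)] nonneg by auto
    have Y1: "0 \<le> ?Y" "?Y \<le> 1"
      using nonneg P by simp (rule conjunct1[OF IH])
    have le: "phi r z ^ c * (phi r (- b k) * ?P) \<le> ?X * ?Y"
    proof -
      have "phi r z ^ c * (phi r (- b k) * ?P) = phi r z ^ d * (?X * ?P)" by (simp add: c)
      also have "\<dots> \<le> phi r (b k) ^ d * (?X * ?P)"
        using power_mono[OF mono nonneg(1), of d] X1 P by (intro mult_right_mono) auto
      finally show ?thesis by (simp add: mult_ac)
    qed
    have "?X * ?Y \<le> 1" using X1 Y1 by (simp add: mult_le_one)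
    moreover have "z = 0 \<and> (\<forall>l\<in>set (k # ks). b l = 0)"
      if "1 \<le> phi r z ^ c * (phi r (- b k) * ?P)"
    proof -
      have "?X = 1" "?Y = 1" using mult_ge_cancel[OF X1 Y1] order_trans[OF that le] by simp_all
      have zero: "b k = 0"
        using \<open>?X = 1\<close> X phi_mult_uminus_le_1(2)[OF r b(1,3)] by simp
      have rest: "\<forall>l\<in>set ks. b l = 0"
        using IH eq_refl[OF sym[OF \<open>?Y = 1\<close>]] by blast
      have "phi r z = 1" using \<open>?X = 1\<close> unfolding zero by simp
      then show ?thesis using zero rest phi_eq_1[OF r Cons.prems(2)] by simp
    qed
    moreover have eq: "(\<Prod>k\<leftarrow>k # ks. phi r (of_int (g k) * b k)) = phi r (- b k) * ?P"
      using 2 by simp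
    ultimately show ?thesis unfolding eq using order_trans[OF le] by blast
  qed
qed

text \<open>The additional unit in the ballot condition permits a single negative factor with no
  earlier partner. Until it occurs the matching runs as in \<open>ballot_prod_le_1\<close>. If it
  never occurs, \<open>1 + r\<close> is at most 2 by itself.\<close>

lemma ballot_prod_le_2:
  fixes g :: "'a \<Rightarrow> int" and b :: "'a \<Rightarrow> real"
  assumes r: "0 \<le> r" "r \<le> 1"
    and "\<forall>k\<in>set ks. (g k = 1 \<or> g k = -1) \<and> 0 \<le> b k \<and> b k \<le> z" "0 \<le> z" "z \<le> 1"
    and "sorted_wrt (\<lambda>k l. b l \<le> b k) ks"
    and "ballot (int c + 1) (map g ks)"
  shows "(1 + r) * (phi r z ^ c * (\<Prod>k\<leftarrow>ks. phi r (of_int (g k) * b k))) \<le> 2 \<and>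
    (2 \<le> (1 + r) * (phi r z ^ c * (\<Prod>k\<leftarrow>ks. phi r (of_int (g k) * b k))) \<longrightarrow>
      (c = 0 \<or> z = 0) \<and> (r = 0 \<or> r = 1) \<and>
      (\<forall>k\<in>set ks. b k = 0 \<or> r = 0 \<and> g k = -1 \<and> b k = 1))"
  using assms(3-)
proof (induction ks arbitrary: c z)
  case Nil
  let ?A = "phi r z ^ c"
  have A: "0 \<le> ?A" "?A \<le> 1" "1 \<le> ?A \<Longrightarrow> c = 0 \<or> z = 0"
    using phi_power_ge_1[OF r, of z c] phi_nonneg[OF r, of z] Nil by auto
  have "(1 + r) * ?A \<le> 2 * 1" using A r by (intro mult_mono) auto
  moreover have "1 + r = 2 \<and> ?A = 1" if "2 \<le> (1 + r) * ?A"
    using mult_ge_cancel[of "1 + r" 2 ?A 1] that A r by auto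
  ultimately show ?case using A by auto
next
  case (Cons k ks)
  let ?P = "\<Prod>k\<leftarrow>ks. phi r (of_int (g k) * b k)"
  have b: "0 \<le> b k" "b k \<le> z" "b k \<le> 1" using Cons.prems by auto
  have prems: "\<forall>l\<in>set ks. (g l = 1 \<or> g l = -1) \<and> 0 \<le> b l \<and> b l \<le> b k"
    "sorted_wrt (\<lambda>k l. b l \<le> b k) ks"
    using Cons.prems by auto
  have P: "0 \<le> ?P" using prod_list_phi_nonneg[OF r prems(1) b(3)] .
  have mono: "phi r z \<le> phi r (b k)" using phi_antimono r b by blast
  have nonneg: "0 \<le> phi r z" "0 \<le> phi r (b k)" "0 \<le> phi r (- b k)"
    using r b Cons.prems by (auto intro!: phi_nonneg)
  consider "g k = 1" | "g k = -1" "c = 0" | d where "g k = -1" "c = Suc d"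
    using Cons.prems by (cases c) auto
  then show ?case
  proof cases
    case 1
    have "ballot (int (Suc c) + 1) (map g ks)" using Cons.prems 1 by (simp add: add_ac)
    then have IH: "(1 + r) * (phi r (b k) ^ Suc c * ?P) \<le> 2"
      "2 \<le> (1 + r) * (phi r (b k) ^ Suc c * ?P) \<Longrightarrow> b k = 0 \<and> (r = 0 \<or> r = 1) \<and>
        (\<forall>k\<in>set ks. b k = 0 \<or> r = 0 \<and> g k = -1 \<and> b k = 1)"
      using Cons.IH[OF prems(1) b(1,3) prems(2), of "Suc c"] by blast+
    have "phi r z ^ c * (phi r (b k) * ?P) \<le> phi r (b k) ^ c * (phi r (b k) * ?P)"
      using power_mono[OF mono nonneg(1), of c] P nonneg by (intro mult_right_mono) auto
    then have "phi r z ^ c * (phi r (b k) * ?P) \<le> phi r (b k) ^ Suc c * ?P"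
      by (simp add: mult_ac)
    then have le: "(1 + r) * (phi r z ^ c * (phi r (b k) * ?P)) \<le> (1 + r) * (phi r (b k) ^ Suc c * ?P)"
      using r by (intro mult_left_mono) auto
    have "(c = 0 \<or> z = 0) \<and> (r = 0 \<or> r = 1) \<and>
        (\<forall>k\<in>set (k # ks). b k = 0 \<or> r = 0 \<and> g k = -1 \<and> b k = 1)"
      if ge: "2 \<le> (1 + r) * (phi r z ^ c * (phi r (b k) * ?P))"
    proof -
      have zero: "b k = 0" and rest: "r = 0 \<or> r = 1"
        "\<forall>k\<in>set ks. b k = 0 \<or> r = 0 \<and> g k = -1 \<and> b k = 1"
        using IH(2)[OF order_trans[OF ge le]] by blast+
      have "(1 + r) * ?P \<le> 2" using IH(1) unfolding zero by simp
      then have "phi r z ^ c * ((1 + r) * ?P) \<le> phi r z ^ c * 2"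
        using nonneg by (intro mult_left_mono) auto
      then have "1 \<le> phi r z ^ c" using ge unfolding zero by (simp add: mult_ac)
      then have "c = 0 \<or> z = 0" using phi_power_ge_1(2)[OF r] Cons.prems(2,3) by blast
      then show ?thesis using zero rest by simp
    qed
    moreover have eq: "(\<Prod>k\<leftarrow>k # ks. phi r (of_int (g k) * b k)) = phi r (b k) * ?P"
      using 1 by simp
    ultimately show ?thesis unfolding eq using order_trans[OF le IH(1)] by blast
  next
    case 2
    \<comment> \<open>This is the unmatched negative factor: the additional unit is spent, so the
      remaining signs obey the plain ballot condition, and \<open>1 + r\<close> absorbs the
      factor.\<close>
    then have "ballot (int 0) (map g ks)" using Cons.prems by simp
    from ballot_prod_le_1[OF r prems(1) b(1,3) prems(2) this, unfolded power_0 mult_1]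
    have P1: "?P \<le> 1" "1 \<le> ?P \<Longrightarrow> \<forall>l\<in>set ks. b l = 0" by blast+
    let ?X = "(1 + r) * phi r (- b k)"
    have X: "0 \<le> ?X" "?X \<le> 2" using one_plus_mult_phi_uminus(1)[OF r b(1,3)] nonneg(3) r by simp_all
    have "?X * ?P \<le> 2 * 1" using X P P1(1) by (intro mult_mono) auto
    moreover have "(r = 0 \<or> r = 1) \<and> (\<forall>k\<in>set (k # ks). b k = 0 \<or> r = 0 \<and> g k = -1 \<and> b k = 1)"
      if "2 \<le> ?X * ?P"
    proof -
      have "?X = 2" "?P = 1" using mult_ge_cancel[OF X P P1(1)] that by simp_all
      then have "\<forall>l\<in>set ks. b l = 0" "r = 1 \<and> b k = 0 \<or> r = 0 \<and> b k = 1"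
        using P1(2) one_plus_mult_phi_uminus(2)[OF r b(1,3)] by simp_all
      then show ?thesis using 2 by auto
    qed
    ultimately show ?thesis using 2 by (simp add: mult.assoc)
  next
    case (3 d)
    have "ballot (int d + 1) (map g ks)" using Cons.prems 3 by (simp add: add_ac)
    note IH = Cons.IH[OF prems(1) b(1,3) prems(2) this]
    let ?X = "phi r z * phi r (- b k)" and ?Y = "(1 + r) * (phi r (b k) ^ d * ?P)"
    have X: "?X \<le> phi r (b k) * phi r (- b k)" using mono nonneg by (simp add: mult_right_mono)
    have X1: "0 \<le> ?X" "?X \<le> 1"
      using X phi_mult_uminus_le_1(1)[OF r b(1,3)] nonneg by auto
    have Y1: "0 \<le> ?Y" "?Y \<le> 2"
      using nonneg P r by simp (rule conjunct1[OF IH])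
    have le: "(1 + r) * (phi r z ^ c * (phi r (- b k) * ?P)) \<le> ?X * ?Y"
    proof -
      have "(1 + r) * (phi r z ^ c * (phi r (- b k) * ?P)) = phi r z ^ d * ((1 + r) * ?X * ?P)"
        by (simp add: 3)
      also have "\<dots> \<le> phi r (b k) ^ d * ((1 + r) * ?X * ?P)"
        using power_mono[OF mono nonneg(1), of d] nonneg P r
        by (intro mult_right_mono mult_nonneg_nonneg) auto
      finally show ?thesis by (simp add: mult_ac)
    qed
    have "?X * ?Y \<le> 1 * 2" using X1 Y1 by (intro mult_mono) auto
    moreover have "z = 0 \<and> (r = 0 \<or> r = 1) \<and>
        (\<forall>k\<in>set (k # ks). b k = 0 \<or> r = 0 \<and> g k = -1 \<and> b k = 1)"
      if "2 \<le> (1 + r) * (phi r z ^ c * (phi r (- b k) * ?P))"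
    proof -
      have "?X = 1" "?Y = 2" using mult_ge_cancel[OF X1 Y1] order_trans[OF that le] by simp_all
      have zero: "b k = 0"
        using \<open>?X = 1\<close> X phi_mult_uminus_le_1(2)[OF r b(1,3)] by simp
      have rest: "r = 0 \<or> r = 1" "\<forall>k\<in>set ks. b k = 0 \<or> r = 0 \<and> g k = -1 \<and> b k = 1"
        using IH eq_refl[OF sym[OF \<open>?Y = 2\<close>]] by blast+
      have "phi r z = 1" using \<open>?X = 1\<close> unfolding zero by simp
      then show ?thesis using zero rest phi_eq_1[OF r Cons.prems(2)] by simp
    qed
    moreover have eq: "(\<Prod>k\<leftarrow>k # ks. phi r (of_int (g k) * b k)) = phi r (- b k) * ?P"
      using 3(1) by simp
    ultimately show ?thesis unfolding eq using order_trans[OF le] by simp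
  qed
qed

section \<open>Vandermonde products of signed kernels\<close>

text \<open>Up to scaling, \<open>vprod p\<close> is a Vandermonde product in the partial products of the vector.\<close>

primrec vprod :: "(nat \<Rightarrow> nat \<Rightarrow> real) \<Rightarrow> nat list \<Rightarrow> real" where
  "vprod p [] = 1"
| "vprod p (i # xs) = (\<Prod>j\<leftarrow>xs. 1 - p i j) * vprod p xs"

lemma prod_list_mult:
  fixes u v :: "'a \<Rightarrow> real"
  shows "(\<Prod>k\<leftarrow>ks. u k * v k) = (\<Prod>k\<leftarrow>ks. u k) * (\<Prod>k\<leftarrow>ks. v k)"
  by (induction ks) auto

lemma vprod_append:
  "vprod p (xs @ ys) = vprod p xs * vprod p ys * (\<Prod>i\<leftarrow>xs. \<Prod>j\<leftarrow>ys. 1 - p i j)"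
  by (induction xs) auto

text \<open>The reversal lists the points from the nearest to the farthest from \<open>i\<close>,
  the order in which the ballot lemmas read them.\<close>

lemma vprod_delete_last: "vprod p (L @ [i]) = vprod p L * (\<Prod>k\<leftarrow>rev L. 1 - p k i)"
  by (simp add: vprod_append rev_map[symmetric] prod_list.rev)

lemma vprod_delete_pair:
  "vprod p (L @ i # j # R) = vprod p (L @ R) *
    ((1 - p i j) * (\<Prod>k\<leftarrow>R. (1 - p j k) * (1 - p i k))) *
    (\<Prod>k\<leftarrow>rev L. (1 - p k i) * (1 - p k j))"
  by (simp add: vprod_append rev_map[symmetric] prod_list.rev prod_list_mult)

text \<open>Abstracting from coordinates lets the induction run over sublists of points with one
  fixed kernel. The condition \<open>signed\<close> holds for any signs where \<open>p i j\<close>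
  is 0, so zero coordinates may be given either sign.\<close>

locale signed_kernel =
  fixes p :: "nat \<Rightarrow> nat \<Rightarrow> real" and s :: "nat \<Rightarrow> int"
  assumes mult: "i < j \<Longrightarrow> j < k \<Longrightarrow> p i k = p i j * p j k"
    and abs_le_1: "i < j \<Longrightarrow> \<bar>p i j\<bar> \<le> 1"
    and sign: "s i = 1 \<or> s i = -1"
    and signed: "i < j \<Longrightarrow> p i j = of_int (s i * s j) * \<bar>p i j\<bar>"
begin

lemma vprod_nonneg: "sorted_wrt (<) xs \<Longrightarrow> 0 \<le> vprod p xs"
proof (induction xs)
  case (Cons i xs)
  have "0 \<le> (\<Prod>j\<leftarrow>xs. 1 - p i j)"
  proof (rule prod_list_nonneg)
    fix y assume "y \<in> set (map (\<lambda>j. 1 - p i j) xs)"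
    then show "0 \<le> y" using Cons.prems abs_le_1[of i] by (force simp: abs_le_iff)
  qed
  then show ?case using Cons by simp
qed simp

lemma abs_antimono_right: "i < j \<Longrightarrow> j < k \<Longrightarrow> \<bar>p i k\<bar> \<le> \<bar>p i j\<bar>"
  using abs_le_1[of j k] by (simp add: mult[of i j k] abs_mult mult_left_le)

lemma abs_antimono_left: "i < j \<Longrightarrow> j < k \<Longrightarrow> \<bar>p i k\<bar> \<le> \<bar>p j k\<bar>"
  using abs_le_1[of i j] by (simp add: mult[of i j k] abs_mult mult_left_le_one_le)

text \<open>By multiplicativity the magnitudes of \<open>p k i\<close> shrink as \<open>k\<close>
  moves away from \<open>i\<close>, so \<open>ballot_prod_le_1\<close> applies to the reversed list
  with empty surplus and threshold 1.\<close>

lemma left_factor_le_1: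
  assumes r: "0 \<le> r" "r \<le> 1" and sorted: "sorted_wrt (<) (L @ [i])"
    and ballot: "ballot 0 (map ((*) (s i)) (rev (map s L)))"
  shows "(\<Prod>k\<leftarrow>rev L. phi r (p k i)) \<le> 1 \<and>
    (1 \<le> (\<Prod>k\<leftarrow>rev L. phi r (p k i)) \<longrightarrow> (\<forall>k\<in>set L. p k i = 0))"
proof -
  let ?g = "\<lambda>k. s i * s k"
  have lt: "k < i" if "k \<in> set L" for k using sorted that by (simp add: sorted_wrt_append)
  have 1: "\<forall>k\<in>set (rev L). (?g k = 1 \<or> ?g k = -1) \<and> 0 \<le> \<bar>p k i\<bar> \<and> \<bar>p k i\<bar> \<le> 1"
    using lt abs_le_1 sign by (metis abs_ge_zero mult_1 mult_minus1 minus_minus set_rev)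
  have "sorted_wrt (<) L" using sorted by (simp add: sorted_wrt_append)
  then have 2: "sorted_wrt (\<lambda>k l. \<bar>p l i\<bar> \<le> \<bar>p k i\<bar>) (rev L)"
    unfolding sorted_wrt_rev
    by (rule sorted_wrt_mono_rel[rotated]) (use abs_antimono_left lt in blast)
  have 3: "ballot (int 0) (map ?g (rev L))" using ballot by (simp add: rev_map o_def)
  have "of_int (?g k) * \<bar>p k i\<bar> = p k i" if "k \<in> set L" for k
    using signed[OF lt[OF that]] by (simp add: mult.commute)
  then have eq: "(\<Prod>k\<leftarrow>rev L. phi r (of_int (?g k) * \<bar>p k i\<bar>)) = (\<Prod>k\<leftarrow>rev L. phi r (p k i))"
    by (intro arg_cong[of _ _ prod_list] map_cong) auto
  show ?thesis
    using ballot_prod_le_1[OF r 1 zero_le_one order_refl 2 3, unfolded eq power_0 mult_1] by simp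
qed

lemma right_factor_le_2:
  assumes r: "0 \<le> r" "r \<le> 1" and sorted: "sorted_wrt (<) (j # R)"
    and ballot: "ballot 1 (map ((*) (s j)) (map s R))"
  shows "(1 + r) * (\<Prod>k\<leftarrow>R. phi r (p j k)) \<le> 2 \<and>
    (2 \<le> (1 + r) * (\<Prod>k\<leftarrow>R. phi r (p j k)) \<longrightarrow>
      (r = 0 \<or> r = 1) \<and> (\<forall>k\<in>set R. p j k = 0 \<or> r = 0 \<and> p j k = -1))"
proof -
  let ?g = "\<lambda>k. s j * s k"
  have lt: "j < k" if "k \<in> set R" for k using sorted that by simp
  have 1: "\<forall>k\<in>set R. (?g k = 1 \<or> ?g k = -1) \<and> 0 \<le> \<bar>p j k\<bar> \<and> \<bar>p j k\<bar> \<le> 1"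
    using lt abs_le_1 sign by (metis abs_ge_zero mult_1 mult_minus1 minus_minus)
  have "sorted_wrt (<) R" using sorted by simp
  then have 2: "sorted_wrt (\<lambda>k l. \<bar>p j l\<bar> \<le> \<bar>p j k\<bar>) R"
    by (rule sorted_wrt_mono_rel[rotated]) (use abs_antimono_right lt in blast)
  have 3: "ballot (int 0 + 1) (map ?g R)" using ballot by (simp add: o_def)
  have g: "of_int (?g k) * \<bar>p j k\<bar> = p j k" if "k \<in> set R" for k
    using signed[OF lt[OF that]] by simp
  then have eq: "(\<Prod>k\<leftarrow>R. phi r (of_int (?g k) * \<bar>p j k\<bar>)) = (\<Prod>k\<leftarrow>R. phi r (p j k))"
    by (intro arg_cong[of _ _ prod_list] map_cong) auto
  have minus: "p j k = -1" if "k \<in> set R" "?g k = -1" "\<bar>p j k\<bar> = 1" for k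
    using g[OF that(1)] unfolding that(2,3) by simp
  note le = ballot_prod_le_2[OF r 1 zero_le_one order_refl 2 3, unfolded eq power_0 mult_1]
  then show ?thesis using minus by (metis abs_eq_0_iff)
qed

theorem vprod_le:
  "sorted_wrt (<) xs \<Longrightarrow> vprod p xs \<le> 2 ^ (length xs div 2) \<and>
    (2 ^ (length xs div 2) \<le> vprod p xs \<longrightarrow> sorted_wrt (\<lambda>i j. p i j \<in> {0, -1}) xs)"
proof (induction xs rule: measure_induct_rule[of length])
  case (less xs)
  show ?case
  proof (cases "xs = []")
    case False
    have "set (map s xs) \<subseteq> {1, -1}" using sign by auto
    then consider (pivot) "pivot (map s xs)"
      | (last) "\<exists>L a. map s xs = L @ [a] \<and> ballot 0 (map ((*) a) (rev L))"
      using pivot_or_dominant_last[of "map s xs"] False by auto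
    then show ?thesis
    proof cases
      case last
      then obtain L i where xs: "xs = L @ [i]"
        and ballot: "ballot 0 (map ((*) (s i)) (rev (map s L)))"
        by (auto simp: map_eq_append_conv)
      have sorted: "sorted_wrt (<) (L @ [i])" "sorted_wrt (<) L"
        using less.prems xs by (auto simp: sorted_wrt_append)
      note C = left_factor_le_1[of 0, OF order_refl zero_le_one sorted(1) ballot]
      let ?C = "\<Prod>k\<leftarrow>rev L. phi 0 (p k i)" and ?M = "2 ^ (length L div 2) :: real"
      have IH: "vprod p L \<le> ?M" "?M \<le> vprod p L \<Longrightarrow> sorted_wrt (\<lambda>i j. p i j \<in> {0, -1}) L"
        using less.IH[of L] sorted xs by auto
      have V: "vprod p xs = vprod p L * ?C" "0 \<le> vprod p L" "0 \<le> ?C"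
      proof -
        show "vprod p xs = vprod p L * ?C" by (simp add: xs vprod_delete_last phi_def)
        show "0 \<le> vprod p L" using vprod_nonneg sorted by blast
        have "0 \<le> phi 0 (p k i)" if "k \<in> set L" for k
          using that sorted abs_le_1[of k i] by (intro phi_nonneg) (auto simp: sorted_wrt_append)
        then show "0 \<le> ?C" by (intro prod_list_nonneg) auto
      qed
      have M: "?M \<le> 2 ^ (length xs div 2)"
        by (intro power_increasing) (auto simp: xs)
      have "vprod p L * ?C \<le> ?M * 1" using IH(1) C V by (intro mult_mono) auto
      then have "vprod p xs \<le> 2 ^ (length xs div 2)" using V(1) M by linarith
      moreover have "sorted_wrt (\<lambda>i j. p i j \<in> {0, -1}) xs" if "2 ^ (length xs div 2) \<le> vprod p xs"
      proof -
        have "vprod p L * ?C \<ge> ?M * 1" using that M V by linarith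
        note eqs = mult_ge_cancel[OF V(2) IH(1) V(3) conjunct1[OF C] _ _ this]
        have "sorted_wrt (\<lambda>i j. p i j \<in> {0, -1}) L" using IH(2) eqs(1) by simp
        moreover have "\<forall>k\<in>set L. p k i = 0" using C eqs(2) by simp
        ultimately show ?thesis by (simp add: xs sorted_wrt_append)
      qed
      ultimately show ?thesis by blast
    next
      case pivot
      then obtain L i j R where xs: "xs = L @ i # j # R" and s: "s j = - s i"
        and ballot: "ballot 1 (map ((*) (s j)) (map s R))"
          "ballot 0 (map ((*) (s i)) (rev (map s L)))"
        unfolding pivot_def by (auto simp: map_eq_append_conv map_eq_Cons_conv)
      have sorted: "sorted_wrt (<) (L @ [i])" "sorted_wrt (<) (j # R)" "sorted_wrt (<) (L @ R)" "i < j"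
        and lt: "\<And>k. k \<in> set L \<Longrightarrow> k < i" "\<And>k. k \<in> set R \<Longrightarrow> j < k"
        using less.prems xs by (auto simp: sorted_wrt_append)
      define r where "r = \<bar>p i j\<bar>"
      have "s i * s j = -1" using s sign[of i] by auto
      then have pij: "p i j = - r" using signed[OF \<open>i < j\<close>] by (simp add: r_def)
      have r: "0 \<le> r" "r \<le> 1" using abs_le_1[OF \<open>i < j\<close>] by (auto simp: r_def)
      have pR: "p i k = - r * p j k" if "k \<in> set R" for k
        using mult[OF \<open>i < j\<close> lt(2)[OF that]] pij by simp
      have pL: "p k j = - r * p k i" if "k \<in> set L" for k
        using mult[OF lt(1)[OF that] \<open>i < j\<close>] pij by simp
      let ?A = "vprod p (L @ R)" and ?B = "(1 + r) * (\<Prod>k\<leftarrow>R. phi r (p j k))"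
        and ?C = "\<Prod>k\<leftarrow>rev L. phi r (p k i)" and ?M = "2 ^ (length (L @ R) div 2) :: real"
      note B = right_factor_le_2[OF r sorted(2) ballot(1)]
      note C = left_factor_le_1[OF r sorted(1) ballot(2)]
      have IH: "?A \<le> ?M" "?M \<le> ?A \<Longrightarrow> sorted_wrt (\<lambda>i j. p i j \<in> {0, -1}) (L @ R)"
        using less.IH[of "L @ R"] sorted xs by auto
      have eqR: "(\<Prod>k\<leftarrow>R. (1 - p j k) * (1 - p i k)) = (\<Prod>k\<leftarrow>R. phi r (p j k))"
        using pR by (intro arg_cong[of _ _ prod_list] map_cong) (auto simp: phi_def)
      have eqL: "(\<Prod>k\<leftarrow>rev L. (1 - p k i) * (1 - p k j)) = ?C"
        using pL by (intro arg_cong[of _ _ prod_list] map_cong) (auto simp: phi_def)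
      have V: "vprod p xs = ?A * ?B * ?C"
        unfolding xs vprod_delete_pair eqR eqL pij by simp
      have A0: "0 \<le> ?A" using vprod_nonneg sorted by blast
      have B0: "0 \<le> ?B"
        using r abs_le_1 lt by (intro mult_nonneg_nonneg prod_list_nonneg) (auto intro!: phi_nonneg)
      have C0: "0 \<le> ?C"
        using r abs_le_1 lt by (intro prod_list_nonneg) (auto intro!: phi_nonneg)
      have AB: "?A * ?B \<le> ?M * 2" using IH(1) A0 B0 B by (intro mult_mono) auto
      have AB0: "0 \<le> ?A * ?B" using A0 B0 by (rule mult_nonneg_nonneg)
      have M: "2 ^ (length xs div 2) = ?M * 2 * 1" by (simp add: xs)
      have "?A * ?B * ?C \<le> ?M * 2 * 1"
        by (rule mult_mono[OF AB conjunct1[OF C] _ C0]) simp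
      moreover have "sorted_wrt (\<lambda>i j. p i j \<in> {0, -1}) xs" if "?M * 2 * 1 \<le> ?A * ?B * ?C"
      proof -
        \<comment> \<open>Equality is peeled off in two rounds: first \<open>?C\<close>, then
          \<open>?A\<close> against \<open>?B\<close>.\<close>
        note eqs = mult_ge_cancel[OF AB0 AB C0 conjunct1[OF C] _ _ that]
        have AB_eq: "?A * ?B = ?M * 2" and C_eq: "?C = 1" using eqs by simp_all
        note eqs' = mult_ge_cancel[OF A0 IH(1) B0 conjunct1[OF B] _ _ eq_refl[OF AB_eq[symmetric]]]
        have A_eq: "?A = ?M" and B_eq: "?B = 2" using eqs' by simp_all
        have "sorted_wrt (\<lambda>i j. p i j \<in> {0, -1}) (L @ R)" using IH(2) A_eq by simp
        moreover have "r = 0 \<or> r = 1" and R: "\<forall>k\<in>set R. p j k = 0 \<or> r = 0 \<and> p j k = -1"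
          using B eq_refl[OF B_eq[symmetric]] by blast+
        \<comment> \<open>A value \<open>p j k = -1\<close> occurs only with \<open>r = 0\<close>,
          and then \<open>p i k = - r * p j k\<close> vanishes.\<close>
        moreover have "\<forall>k\<in>set R. p i k = 0" using R pR by auto
        moreover have "\<forall>k\<in>set L. p k i = 0" using C eq_refl[OF C_eq[symmetric]] by blast
        moreover from this have "\<forall>k\<in>set L. p k j = 0" using pL by simp
        ultimately show ?thesis by (auto simp: xs sorted_wrt_append pij)
      qed
      ultimately show ?thesis unfolding V M by blast
    qed
  qed simp
qed

end

section \<open>Transfer to \<open>f\<close> and the extremal vectors\<close>

text \<open>A pair of points \<open>i < j\<close> among \<open>0, ..., n\<close> stands for the
  interval from \<open>i + 1\<close> to \<open>j\<close>. In the induction, the new intervals are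
  those ending at \<open>Suc n\<close>, that is, the factors of the new last point.\<close>

lemma f_eq_vprod: "f n x = vprod (\<lambda>i j. \<Prod>k\<in>{i<..j}. x k) [0..<Suc n]"
proof (induction n)
  case 0
  have "{(i, j). 1 \<le> i \<and> i \<le> j \<and> j \<le> (0::nat)} = {}" by auto
  then show ?case unfolding f_def by (simp only:) simp
next
  case (Suc n)
  let ?S = "\<lambda>n::nat. {(i, j). 1 \<le> i \<and> i \<le> j \<and> j \<le> n}"
  let ?F = "\<lambda>(i, j). 1 - (\<Prod>k = i..j. x k)"
  have "finite (?S n)" by (rule finite_subset[of _ "{..n} \<times> {..n}"]) auto
  moreover have "?S (Suc n) = ?S n \<union> (\<lambda>i. (Suc i, Suc n)) ` {..<Suc n}"
  proof (intro set_eqI)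
    fix q :: "nat \<times> nat"
    show "q \<in> ?S (Suc n) \<longleftrightarrow> q \<in> ?S n \<union> (\<lambda>i. (Suc i, Suc n)) ` {..<Suc n}"
      by (cases q; cases "fst q") (auto simp: image_iff le_Suc_eq)
  qed
  ultimately have "f (Suc n) x = f n x * prod ?F ((\<lambda>i. (Suc i, Suc n)) ` {..<Suc n})"
    unfolding f_def by (auto intro: prod.union_disjoint)
  also have "prod ?F ((\<lambda>i. (Suc i, Suc n)) ` {..<Suc n}) = (\<Prod>i<Suc n. 1 - (\<Prod>k\<in>{i<..Suc n}. x k))"
    by (subst prod.reindex) (auto simp: inj_on_def atLeastSucAtMost_greaterThanAtMost)
  also have "\<dots> = (\<Prod>i\<leftarrow>rev [0..<Suc n]. 1 - (\<Prod>k\<in>{i<..Suc n}. x k))"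
    using prod.distinct_set_conv_list[of "rev [0..<Suc n]" "\<lambda>i. 1 - (\<Prod>k\<in>{i<..Suc n}. x k)"]
    by (simp add: atLeast0LessThan del: upt_Suc)
  also have "f n x * \<dots> = vprod (\<lambda>i j. \<Prod>k\<in>{i<..j}. x k) ([0..<Suc n] @ [Suc n])"
    by (simp only: Suc.IH vprod_delete_last)
  also have "[0..<Suc n] @ [Suc n] = [0..<Suc (Suc n)]" by simp
  finally show ?case .
qed

lemma prod_greaterThanAtMost_split:
  fixes i j k :: nat
  assumes "i \<le> j" "j \<le> k"
  shows "prod u {i<..k} = prod u {i<..j} * prod u {j<..k}"
proof -
  have "{i<..k} = {i<..j} \<union> {j<..k}" using assms by auto
  then show ?thesis by (simp add: prod.union_disjoint)
qed

text \<open>In the product of the signs of two points the common initial segment squares to 1,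
  leaving the sign of the coordinates between them.\<close>

lemma signed_kernel_interval_prod:
  assumes x: "\<And>t. \<bar>x t\<bar> \<le> 1"
  shows "signed_kernel (\<lambda>i j. \<Prod>k\<in>{i<..j}. x k) (\<lambda>j. \<Prod>k\<in>{0<..j}. if 0 \<le> x k then 1 else -1)"
proof -
  let ?p = "\<lambda>i j. \<Prod>k\<in>{i<..j}. x k" and ?e = "\<lambda>k. if 0 \<le> x k then 1 else -1 :: int"
  have sign: "prod ?e A = 1 \<or> prod ?e A = -1" for A
    by (induction A rule: infinite_finite_induct) auto
  show ?thesis
  proof
    show "?p i k = ?p i j * ?p j k" if "i < j" "j < k" for i j k
      using that by (intro prod_greaterThanAtMost_split) auto
    show "\<bar>?p i j\<bar> \<le> 1" if "i < j" for i j
      unfolding abs_prod by (rule prod_le_1) (use x in auto)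
    show "prod ?e {0<..i} = 1 \<or> prod ?e {0<..i} = -1" for i by (rule sign)
    show "?p i j = of_int (prod ?e {0<..i} * prod ?e {0<..j}) * \<bar>?p i j\<bar>" if "i < j" for i j
    proof -
      have "prod ?e {0<..i} * prod ?e {0<..j} = prod ?e {i<..j}"
        using prod_greaterThanAtMost_split[of 0 i j ?e] sign[of "{0<..i}"] that by auto
      moreover have "of_int (prod ?e {i<..j}) * \<bar>?p i j\<bar> = (\<Prod>k\<in>{i<..j}. of_int (?e k) * \<bar>x k\<bar>)"
        by (simp add: abs_prod prod.distrib)
      moreover have "of_int (?e k) * \<bar>x k\<bar> = x k" for k by simp
      ultimately show ?thesis by simp
    qed
  qed
qed

text \<open>For the equality case, kernel values of adjacent points are the coordinates, and those
  of points at distance two are products of neighbours. Two consecutive -1 would give the forbidden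
  kernel value 1.\<close>

lemma f_le:
  assumes "\<forall>t \<in> {1..n}. x t \<in> {-1..1}"
  shows "f n x \<le> 2 ^ ((n + 1) div 2)"
    and "2 ^ ((n + 1) div 2) \<le> f n x \<Longrightarrow>
      zero_minus_one_vector n x \<and> no_consecutive_minus_ones n x"
proof -
  \<comment> \<open>The kernel lemmas need bounds on all coordinates, also those beyond \<open>n\<close>.\<close>
  define x' where "x' t = (if t \<in> {1..n} then x t else 0)" for t
  have "f n x = f n x'"
    unfolding f_def by (intro prod.cong) (auto simp: x'_def intro!: prod.cong)
  then have f: "f n x = vprod (\<lambda>i j. \<Prod>k\<in>{i<..j}. x' k) [0..<Suc n]"
    by (simp only: f_eq_vprod)
  have "\<bar>x' t\<bar> \<le> 1" for t using assms by (auto simp: x'_def abs_le_iff)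
  then interpret signed_kernel "\<lambda>i j. \<Prod>k\<in>{i<..j}. x' k"
    "\<lambda>j. \<Prod>k\<in>{0<..j}. if 0 \<le> x' k then 1 else -1"
    by (rule signed_kernel_interval_prod)
  note V = vprod_le[of "[0..<Suc n]", OF sorted_wrt_upt, folded f]
  show "f n x \<le> 2 ^ ((n + 1) div 2)" using V by (simp del: upt_Suc)
  assume "2 ^ ((n + 1) div 2) \<le> f n x"
  then have "sorted_wrt (\<lambda>i j. (\<Prod>k\<in>{i<..j}. x' k) \<in> {0, -1}) [0..<Suc n]"
    using V by (simp del: upt_Suc)
  then have p: "(\<Prod>k\<in>{i<..j}. x' k) \<in> {0, -1}" if "i < j" "j \<le> n" for i j
    using that by (auto simp: sorted_wrt_iff_nth_less simp del: upt_Suc)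
  have x01: "x t \<in> {0, -1}" if t: "1 \<le> t" "t \<le> n" for t
  proof -
    have "{t - 1<..t} = {t}" using t by auto
    then show ?thesis using p[of "t - 1" t] t by (simp add: x'_def)
  qed
  moreover have "\<not> (x t = -1 \<and> x (t + 1) = -1)" if t: "1 \<le> t" "t + 1 \<le> n" for t
  proof -
    have "{t - 1<..t + 1} = {t, t + 1}" using t by auto
    moreover have "t - 1 < t + 1" by simp
    ultimately show ?thesis using p[of "t - 1" "t + 1"] t by (auto simp: x'_def)
  qed
  ultimately show "zero_minus_one_vector n x \<and> no_consecutive_minus_ones n x"
    by (auto simp: zero_minus_one_vector_def no_consecutive_minus_ones_def)
qed

text \<open>Every interval except a single -1 contains a zero, since a -1 is followed by 0; its
  factor is 1. Each single -1 contributes 2.\<close>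

lemma f_zero_minus_one_vector:
  assumes "zero_minus_one_vector n x" "no_consecutive_minus_ones n x"
  shows "f n x = 2 ^ num_minus_ones n x"
proof -
  let ?S = "{(i, j). 1 \<le> i \<and> i \<le> j \<and> j \<le> n}" and ?D = "{t \<in> {1..n}. x t = -1}"
  let ?F = "\<lambda>(i, j). 1 - (\<Prod>k = i..j. x k)"
  have x: "x t = 0 \<or> x t = -1" if "1 \<le> t" "t \<le> n" for t
    using assms(1) that by (auto simp: zero_minus_one_vector_def)
  have "finite ?S" by (rule finite_subset[of _ "{..n} \<times> {..n}"]) auto
  then have "f n x = prod ?F ((\<lambda>t. (t, t)) ` ?D)"
    unfolding f_def
  proof (rule prod.mono_neutral_right)
    show "\<forall>q \<in> ?S - (\<lambda>t. (t, t)) ` ?D. ?F q = 1"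
    proof clarify
      fix i j assume ij: "1 \<le> i" "i \<le> j" "j \<le> n" "(i, j) \<notin> (\<lambda>t. (t, t)) ` ?D"
      have "\<exists>k\<in>{i..j}. x k = 0"
      proof (cases "x i = 0")
        case False
        then have "x i = -1" using x[of i] ij by simp
        then have "i < j" using ij by (cases "i = j") auto
        then have "x (i + 1) = 0"
          using x[of "i + 1"] assms(2) ij \<open>x i = -1\<close> by (auto simp: no_consecutive_minus_ones_def)
        then show ?thesis using \<open>i < j\<close> by (intro bexI[of _ "i + 1"]) auto
      qed (use ij in auto)
      then have "(\<Prod>k = i..j. x k) = 0" by (intro prod_zero) auto
      then show "1 - (\<Prod>k = i..j. x k) = 1" by simp
    qed
  qed auto
  also have "\<dots> = (\<Prod>t\<in>?D. 2)"
    by (subst prod.reindex) (auto simp: inj_on_def)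
  finally show ?thesis by (simp add: num_minus_ones_def)
qed

lemma card_odd: "card {t \<in> {1..n}. odd t} = (n + 1) div 2"
proof (induction n)
  case (Suc n)
  have "{t \<in> {1..Suc n}. odd t} =
      (if even n then insert (Suc n) {t \<in> {1..n}. odd t} else {t \<in> {1..n}. odd t})"
    by (auto simp: le_Suc_eq)
  then show ?case using Suc.IH by auto
qed simp

theorem mainTheorem1:
  fixes n :: nat and x :: "nat \<Rightarrow> real"
  assumes "n \<ge> 1"
    and "\<forall>t \<in> {1..n}. x t \<in> {-1..1}"
  shows "f n x \<le> 2 ^ nat \<lfloor>(real n + 1) / 2\<rfloor> \<and>
    (f n x = 2 ^ nat \<lfloor>(real n + 1) / 2\<rfloor> \<longleftrightarrow>
      zero_minus_one_vector n x \<and>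
      no_consecutive_minus_ones n x \<and>
      (\<forall>y. zero_minus_one_vector n y \<and> no_consecutive_minus_ones n y \<longrightarrow>
        num_minus_ones n y \<le> num_minus_ones n x))"
proof -
  have floor: "nat \<lfloor>(real n + 1) / 2\<rfloor> = (n + 1) div 2"
    using floor_divide_of_nat_eq[of "n + 1" 2, where ?'a = real] by (simp add: add.commute)
  \<comment> \<open>The combinatorial bound comes from the analytic one: \<open>f n y\<close> is 2
    to the number of minus ones.\<close>
  have num_le: "num_minus_ones n y \<le> (n + 1) div 2"
    if "zero_minus_one_vector n y" "no_consecutive_minus_ones n y" for y
  proof -
    have "\<forall>t\<in>{1..n}. y t \<in> {-1..1}" using that(1) by (force simp: zero_minus_one_vector_def)
    then have "(2::real) ^ num_minus_ones n y \<le> 2 ^ ((n + 1) div 2)"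
      using f_le(1)[of n y] f_zero_minus_one_vector[OF that] by simp
    then show ?thesis by simp
  qed
  \<comment> \<open>Placing -1 at the odd positions attains the bound, so a maximal count equals
    \<open>(n + 1) div 2\<close>.\<close>
  let ?a = "\<lambda>t. if odd t then -1 else 0 :: real"
  have alternating: "zero_minus_one_vector n ?a" "no_consecutive_minus_ones n ?a"
    "num_minus_ones n ?a = (n + 1) div 2"
  proof -
    have "{t \<in> {1..n}. ?a t = -1} = {t \<in> {1..n}. odd t}" by auto
    then show "num_minus_ones n ?a = (n + 1) div 2"
      unfolding num_minus_ones_def using card_odd by simp
  qed (auto simp: zero_minus_one_vector_def no_consecutive_minus_ones_def)
  show ?thesis
    unfolding floor
  proof (intro conjI iffI)
    show "f n x \<le> 2 ^ ((n + 1) div 2)" using f_le(1) assms(2) by blast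
  next
    assume eq: "f n x = 2 ^ ((n + 1) div 2)"
    then show zm: "zero_minus_one_vector n x" and nc: "no_consecutive_minus_ones n x"
      using f_le(2)[OF assms(2)] by auto
    have "num_minus_ones n x = (n + 1) div 2"
      using eq f_zero_minus_one_vector[OF zm nc] by simp
    then show "\<forall>y. zero_minus_one_vector n y \<and> no_consecutive_minus_ones n y \<longrightarrow>
        num_minus_ones n y \<le> num_minus_ones n x"
      using num_le by simp
  next
    assume max: "zero_minus_one_vector n x \<and> no_consecutive_minus_ones n x \<and>
      (\<forall>y. zero_minus_one_vector n y \<and> no_consecutive_minus_ones n y \<longrightarrow>
        num_minus_ones n y \<le> num_minus_ones n x)"
    then have "num_minus_ones n x = (n + 1) div 2"
      using num_le[of x] alternating by (metis order_antisym)
    then show "f n x = 2 ^ ((n + 1) div 2)" using f_zero_minus_one_vector max by metis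
  qed
qed

end
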